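(* Let $\mathcal{D}=B_X$ be the open unit ball of a complex Banach space $X$. Suppose that $\mathcal{D}$ is complex uniformly convex and that there are constants $A>0$, $s>0$ such that the modulus of complex convexity satisfies $\delta_{\mathcal{D}}(\varepsilon)\le A\varepsilon^s$ for all $\varepsilon>0$. Then every complex geodesic $\phi:\mathbb{D}\to\mathcal{D}$ extends to a continuous function $\phi:\overline{\mathbb{D}}\to\overline{\mathcal{D}}$.
   Context: $\mathbb{D}$ is the open unit disc in $\mathbb{C}$ and $\rho(z,w)=\tanh^{-1}\left|\frac{z-w}{1-\bar w z}\right|$ is the Poincaré distance. $H(\mathcal{D}_1,\mathcal{D}_2)$ is the set of holomorphic maps from $\mathcal{D}_1$ to $\mathcal{D}_2$. The Carathéodory distance on $\mathcal{D}$ is $C_{\mathcal{D}}(p,q)=\sup\{\rho(f(p),f(q)): f\in H(\mathcal{D},\mathbb{D})\}$. A map $\phi\in H(\mathbb{D},\mathcal{D})$ is a complex geodesic if $\rho(u,v)=C_{\mathcal{D}}(\phi(u),\phi(v))$ for all $u,v\in\mathbb{D}$. For a domain $\mathcal{D}\subset X$, $z\in\mathcal{D}$ and $v\in X$ with $\|v\|=1$, let $\delta_{\mathcal{D}}(z,v)=\sup\{r>0: z+rv\mathbb{D}\subset\mathcal{D}\}$. The modulus of complex convexity of $\mathcal{D}$ is $$\delta_{\mathcal{D}}(\varepsilon)=\sup\{\delta_{\mathcal{D}}(z,v): z\in\mathcal{D},\ d(z,\partial\mathcal{D})\le\varepsilon,\ \|v\|=1\},$$ where $d(z,\partial\mathcal{D})$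 is the distance from $z$ to the boundary. $\mathcal{D}$ is complex uniformly convex if $\delta_{\mathcal{D}}(\varepsilon)\to0$ as $\varepsilon\to0$. *)

theory Defs
  imports "HOL-Analysis.Analysis"
begin

class complex_normed_vector = real_normed_vector +
  fixes scaleC :: "complex \<Rightarrow> 'a \<Rightarrow> 'a"  (infixr "*\<^sub>C" 75)
  assumes scaleC_add_right: "c *\<^sub>C (x + y) = c *\<^sub>C x + c *\<^sub>C y"
    and scaleC_add_left: "(c + d) *\<^sub>C x = c *\<^sub>C x + d *\<^sub>C x"
    and scaleC_scaleC: "c *\<^sub>C d *\<^sub>C x = (c * d) *\<^sub>C x"
    and scaleC_one: "1 *\<^sub>C x = x"
    and scaleC_of_real: "of_real r *\<^sub>C x = r *\<^sub>R x"
    and norm_scaleC: "norm (c *\<^sub>C x) = norm c * norm x"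

class complex_banach = complex_normed_vector + banach

instantiation complex :: complex_banach
begin

definition scaleC_complex :: "complex \<Rightarrow> complex \<Rightarrow> complex"
  where "scaleC_complex c x = c * x"

instance
  by standard (auto simp: scaleC_complex_def algebra_simps norm_mult scaleR_conv_of_real)

end

text \<open>Frechet-holomorphic maps: on an open set, holomorphy is real Frechet differentiability
  with complex linear derivatives. Values outside \<open>D\<^sub>1\<close> are irrelevant.\<close>

definition holomorphic_maps ::
    "'a::complex_normed_vector set \<Rightarrow> 'b::complex_normed_vector set \<Rightarrow> ('a \<Rightarrow> 'b) set"
  where "holomorphic_maps D\<^sub>1 D\<^sub>2 =
    {f. (\<forall>x\<in>D\<^sub>1. \<exists>f'. (f has_derivative f') (at x) \<and> (\<forall>c v. f' (c *\<^sub>C v) = c *\<^sub>C f' v))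
        \<and> f ` D\<^sub>1 \<subseteq> D\<^sub>2}"

lemma holomorphic_maps_complex_iff:
  fixes f :: "complex \<Rightarrow> complex"
  assumes "open D\<^sub>1"
  shows "f \<in> holomorphic_maps D\<^sub>1 D\<^sub>2 \<longleftrightarrow> f holomorphic_on D\<^sub>1 \<and> f ` D\<^sub>1 \<subseteq> D\<^sub>2"
proof -
  have "(\<exists>f'. (f has_derivative f') (at x) \<and> (\<forall>c v. f' (c *\<^sub>C v) = c *\<^sub>C f' v))
      \<longleftrightarrow> f field_differentiable at x" for x
  proof
    assume "\<exists>f'. (f has_derivative f') (at x) \<and> (\<forall>c v. f' (c *\<^sub>C v) = c *\<^sub>C f' v)"
    then obtain f' where f': "(f has_derivative f') (at x)"
      and lin: "\<And>c v. f' (c * v) = c * f' v"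
      by (auto simp: scaleC_complex_def)
    have "f' v = f' 1 * v" for v
      using lin[of v 1] by (metis mult.commute mult.right_neutral)
    then have "f' = (*) (f' 1)"
      by (rule ext)
    with f' have "(f has_field_derivative f' 1) (at x)"
      unfolding has_field_derivative_def by metis
    then show "f field_differentiable at x"
      unfolding field_differentiable_def by blast
  next
    assume "f field_differentiable at x"
    then obtain d where d: "(f has_derivative (*) d) (at x)"
      by (auto simp: field_differentiable_def has_field_derivative_def)
    show "\<exists>f'. (f has_derivative f') (at x) \<and> (\<forall>c v. f' (c *\<^sub>C v) = c *\<^sub>C f' v)"
      by (rule exI[of _ "(*) d"]) (simp add: d scaleC_complex_def mult.left_commute)
  qed
  then show ?thesis
    using assms by (auto simp: holomorphic_maps_def holomorphic_on_def
        at_within_open[OF _ assms])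
qed

definition poincare_dist :: "complex \<Rightarrow> complex \<Rightarrow> real"
  where "poincare_dist z w = artanh (norm ((z - w) / (1 - cnj w * z)))"

text \<open>Suprema are taken in \<^typ>\<open>ennreal\<close>, so that no boundedness has to be known in advance.\<close>

definition caratheodory_dist :: "'a::complex_normed_vector set \<Rightarrow> 'a \<Rightarrow> 'a \<Rightarrow> ennreal"
  where "caratheodory_dist D p q =
    (SUP f\<in>holomorphic_maps D (ball 0 1). ennreal (poincare_dist (f p) (f q)))"

definition complex_geodesic :: "'a::complex_normed_vector set \<Rightarrow> (complex \<Rightarrow> 'a) \<Rightarrow> bool"
  where "complex_geodesic D \<phi> \<longleftrightarrow> \<phi> \<in> holomorphic_maps (ball 0 1) D \<and>
    (\<forall>u\<in>ball 0 1. \<forall>v\<in>ball 0 1. ennreal (poincare_dist u v) = caratheodory_dist D (\<phi> u) (\<phi> v))"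

definition disc_radius :: "'a::complex_normed_vector set \<Rightarrow> 'a \<Rightarrow> 'a \<Rightarrow> ennreal"
  where "disc_radius D z v =
    (SUP r\<in>{r::real. r > 0 \<and> (\<lambda>\<zeta>. z + r *\<^sub>R \<zeta> *\<^sub>C v) ` ball 0 1 \<subseteq> D}. ennreal r)"

text \<open>For \<open>D = UNIV\<close> the frontier is empty and \<^const>\<open>infdist\<close> to it is \<open>0\<close>
  by convention; every other nonempty open set has a nonempty frontier.\<close>

definition complex_convexity_modulus :: "'a::complex_normed_vector set \<Rightarrow> real \<Rightarrow> ennreal"
  where "complex_convexity_modulus D \<epsilon> =
    (SUP (z, v)\<in>{(z, v). z \<in> D \<and> infdist z (frontier D) \<le> \<epsilon> \<and> norm v = 1}. disc_radius D z v)"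

definition complex_uniformly_convex :: "'a::complex_normed_vector set \<Rightarrow> bool"
  where "complex_uniformly_convex D \<longleftrightarrow>
    (complex_convexity_modulus D \<longlongrightarrow> 0) (at_right 0)"

end

theory Submission
  imports Defs "HOL-Real_Asymp.Real_Asymp" "HOL-Complex_Analysis.Riemann_Mapping"
begin

text \<open>A geodesic cannot approach the boundary too slowly: comparing \<open>C(\<phi>(u), \<phi>(0))\<close> with the
  distances from the origin, which the Schwarz-Pick lemma controls, gives
  \<open>1 - \<parallel>\<phi>(u)\<parallel> \<le> K (1 - |u|)\<close>. Testing \<open>\<phi>\<close> on the disc about \<open>u\<close> against norming functionals, and
  using \<open>a + (1 - a\<^sup>2) / 2 < 1\<close> for \<open>a < 1\<close>, shows that the affine disc with centre \<open>\<phi>(u)\<close>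
  and radius vector \<open>(1 - |u|) \<phi>'(u) / 2\<close> lies in the unit ball. The modulus of complex convexity
  therefore bounds \<open>\<parallel>\<phi>'(u)\<parallel>\<close> by a multiple of \<open>(1 - |u|)\<^sup>s\<^sup>-\<^sup>1\<close>, where \<open>s \<le> 1\<close> without loss of
  generality. This is integrable along radii uniformly in the direction, so the dilations
  \<open>z \<mapsto> \<phi>(r z)\<close> converge uniformly on the closed disc as \<open>r \<rightarrow> 1\<close>.\<close>

subsection \<open>Norming functionals\<close>

text \<open>Homogeneity is asked only as an inequality for \<open>t > 0\<close>, a form easily
  checked for infima of functionals; equality follows in \<open>sublinear_scale\<close>.\<close>

definition sublinear :: "('a::real_vector \<Rightarrow> real) \<Rightarrow> bool"
  where "sublinear p \<longleftrightarrow> (\<forall>x y. p (x + y) \<le> p x + p y) \<and> (\<forall>t>0. \<forall>x. p (t *\<^sub>R x) \<le> t * p x)"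

lemma sublinear_add: "sublinear p \<Longrightarrow> p (x + y) \<le> p x + p y"
  by (simp add: sublinear_def)

lemma sublinear_scale:
  assumes "sublinear p" and "t \<ge> 0"
  shows "p (t *\<^sub>R x) = t * p x"
proof (cases "t = 0")
  case True
  \<comment> \<open>Subadditivity gives \<open>p 0 \<ge> 0\<close> and scaling by \<open>1/2\<close>
    gives \<open>p 0 \<le> p 0 / 2\<close>, so \<open>p 0 = 0\<close>.\<close>
  have "p 0 \<le> p 0 + p 0"
    using sublinear_add[OF assms(1), of 0 0] by simp
  moreover have "\<forall>t>0. \<forall>x. p (t *\<^sub>R x) \<le> t * p x"
    using assms(1) by (simp add: sublinear_def)
  then have "p ((1/2) *\<^sub>R 0) \<le> (1/2) * p 0"
    by (metis half_gt_zero_iff zero_less_one)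
  ultimately show ?thesis
    using True by simp
next
  case False
  then have t: "t > 0" using assms by simp
  have le: "p (r *\<^sub>R y) \<le> r * p y" if "r > 0" for r y
    using assms(1) that by (simp add: sublinear_def)
  have "p ((1 / t) *\<^sub>R (t *\<^sub>R x)) \<le> (1 / t) * p (t *\<^sub>R x)"
    using t by (intro le) simp
  then have "t * p x \<le> p (t *\<^sub>R x)"
    using t by (simp add: field_simps)
  with le[OF t, of x] show ?thesis by simp
qed

lemma sublinear_lower_bound: "sublinear p \<Longrightarrow> - p (- x) \<le> p x"
  using sublinear_add[of p x "- x"] sublinear_scale[of p 0 0] by simp

text \<open>Take the infimum over \<open>t \<ge> 0\<close> of
  \<open>p (x + t *\<^sub>R y) - t * p y\<close>: the choice \<open>t = 0\<close> puts it below
  \<open>p\<close>, and \<open>t = 1\<close> at \<open>- y\<close> gives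
  \<open>p 0 - p y = - p y\<close>.\<close>

lemma sublinear_descent:
  assumes p: "sublinear p"
  obtains q where "sublinear q" and "q \<le> p" and "q (- y) \<le> - p y"
proof -
  define F where "F x t = p (x + t *\<^sub>R y) - t * p y" for x t
  define q where "q x = (INF t\<in>{0..}. F x t)" for x
  \<comment> \<open>This bound does not depend on \<open>t\<close>, so the real infimum
    \<open>q x\<close> is a genuine one.\<close>
  have F_ge: "- p (- x) \<le> F x t" if "t \<ge> 0" for x t
    using sublinear_add[OF p, of "x + t *\<^sub>R y" "- x"] sublinear_scale[OF p that, of y]
    by (simp add: F_def)
  have q_le: "q x \<le> F x t" if "t \<ge> 0" for x t
    unfolding q_def using that F_ge by (intro cINF_lower bdd_belowI2) auto
  have q_ge: "a \<le> q x" if "\<And>t. t \<ge> 0 \<Longrightarrow> a \<le> F x t" for x a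
    unfolding q_def using that by (intro cINF_greatest) auto
  have F_add: "F (x + x') (t + t') \<le> F x t + F x' t'" for x x' t t'
    using sublinear_add[OF p, of "x + t *\<^sub>R y" "x' + t' *\<^sub>R y"]
    by (simp add: F_def algebra_simps)
  have F_scale: "F (r *\<^sub>R x) (r * t) = r * F x t" if "r \<ge> 0" for r x t
    using sublinear_scale[OF p that, of "x + t *\<^sub>R y"] by (simp add: F_def algebra_simps)
  have "q (x + x') \<le> q x + q x'" for x x'
  proof -
    have "q (x + x') - F x t \<le> q x'" if "t \<ge> 0" for t
    proof (rule q_ge)
      fix t' :: real assume "t' \<ge> 0"
      then show "q (x + x') - F x t \<le> F x' t'"
        using F_add[of x x' t t'] q_le[of "t + t'" "x + x'"] that by simp
    qed
    then have "q (x + x') - q x' \<le> q x"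
      by (intro q_ge) (simp add: algebra_simps)
    then show ?thesis by simp
  qed
  moreover have "q (r *\<^sub>R x) \<le> r * q x" if "r > 0" for r x
  proof -
    have "q (r *\<^sub>R x) / r \<le> q x"
    proof (rule q_ge)
      fix t :: real assume "t \<ge> 0"
      then show "q (r *\<^sub>R x) / r \<le> F x t"
        using q_le[of "r * t" "r *\<^sub>R x"] F_scale[of r x t] that by (simp add: field_simps)
    qed
    then show ?thesis using that by (simp add: field_simps)
  qed
  ultimately have "sublinear q"
    by (simp add: sublinear_def)
  moreover have "q \<le> p"
    using q_le[of 0] by (simp add: F_def le_fun_def)
  moreover have "q (- y) \<le> - p y"
    using q_le[of 1 "- y"] sublinear_scale[OF p, of 0 0] by (simp add: F_def)
  ultimately show ?thesis by (rule that)
qed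

text \<open>By minimality, descent along \<open>y\<close> returns \<open>p\<close> itself, so
  \<open>p\<close> is odd. Oddness turns subadditivity into additivity and extends homogeneity to
  negative factors.\<close>

lemma linear_if_minimal_sublinear:
  assumes p: "sublinear p" and min: "\<And>q. sublinear q \<Longrightarrow> q \<le> p \<Longrightarrow> q = p"
  shows "linear p"
proof -
  have "p (- y) \<le> - p y" for y
    using sublinear_descent[OF p, of y] min by metis
  then have minus: "p (- y) = - p y" for y
    using sublinear_lower_bound[OF p, of y] by (smt (verit))
  show ?thesis
  proof
    show "p (x + y) = p x + p y" for x y
      using sublinear_add[OF p, of x y] sublinear_add[OF p, of "x + y" "- y"] minus[of y] by simp
    show "p (r *\<^sub>R x) = r *\<^sub>R p x" for r x
      using sublinear_scale[OF p, of r x] sublinear_scale[OF p, of "- r" x] minus[of "r *\<^sub>R x"]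
      by (cases "r \<ge> 0") auto
  qed
qed

text \<open>A form of the Hahn-Banach theorem: by Zorn's lemma there is a minimal sublinear functional
  below \<open>p\<close>, and a minimal one is odd by \<open>sublinear_descent\<close>, hence linear.\<close>

lemma linear_below_sublinear:
  fixes p :: "'a::real_vector \<Rightarrow> real"
  assumes p: "sublinear p"
  obtains l where "linear l" and "l \<le> p"
proof -
  define A where "A = {q. sublinear q \<and> q \<le> p}"
  \<comment> \<open>Zorn's lemma is applied to the reversed order: its maximal element is a minimal
    functional, and a nonempty chain is bounded by its pointwise infimum.\<close>
  have "\<exists>m\<in>A. \<forall>a\<in>A. m \<ge> a \<longrightarrow> a = m"
  proof (rule predicate_Zorn)
    show "partial_order_on A (relation_of (\<lambda>x y. x \<ge> y) A)"
      by (rule partial_order_on_relation_ofI) auto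
    fix C assume C: "C \<in> Chains (relation_of (\<lambda>x y. x \<ge> y) A)"
    then have CA: "C \<subseteq> A" and chain: "\<And>f g. f \<in> C \<Longrightarrow> g \<in> C \<Longrightarrow> f \<le> g \<or> g \<le> f"
      by (auto simp: Chains_def relation_of_def)
    show "\<exists>u\<in>A. \<forall>a\<in>C. a \<ge> u"
    proof (cases "C = {}")
      case True
      with p show ?thesis by (auto simp: A_def)
    next
      case False
      define u where "u x = (INF q\<in>C. q x)" for x
      have sub: "sublinear q" and qp: "q x \<le> p x" if "q \<in> C" for q x
        using that CA by (auto simp: A_def le_fun_def)
      have "- p (- x) \<le> q x" if "q \<in> C" for q x
        using sublinear_lower_bound[OF sub[OF that], of x] qp[OF that, of "- x"] by simp
      then have u_le: "u x \<le> q x" if "q \<in> C" for q x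
        unfolding u_def using that by (intro cINF_lower bdd_belowI2) auto
      have u_ge: "a \<le> u x" if "\<And>q. q \<in> C \<Longrightarrow> a \<le> q x" for x a
        unfolding u_def using that False by (intro cINF_greatest) auto
      have "u (x + y) \<le> u x + u y" for x y
      proof -
        \<comment> \<open>In a chain one member \<open>h\<close> lies below both \<open>f\<close>
          and \<open>g\<close>, and subadditivity of \<open>h\<close> passes to the infimum.\<close>
        have "u (x + y) \<le> f x + g y" if fg: "f \<in> C" "g \<in> C" for f g
        proof -
          obtain h where "h \<in> C" "h \<le> f" "h \<le> g"
            using chain[OF fg] fg by blast
          then show ?thesis
            using u_le[of h "x + y"] sublinear_add[OF sub, of h x y]
            by (smt (verit) le_funD)
        qed
        then have "u (x + y) - f x \<le> g y" if "f \<in> C" "g \<in> C" for f g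
          using that by (simp add: algebra_simps)
        then have "u (x + y) - f x \<le> u y" if "f \<in> C" for f
          using that by (intro u_ge)
        then have "u (x + y) - u y \<le> u x"
          by (intro u_ge) (simp add: algebra_simps)
        then show ?thesis by simp
      qed
      moreover have "u (t *\<^sub>R x) \<le> t * u x" if "t > 0" for t x
      proof -
        have "u (t *\<^sub>R x) / t \<le> u x"
        proof (rule u_ge)
          fix q assume "q \<in> C"
          then show "u (t *\<^sub>R x) / t \<le> q x"
            using u_le[of q "t *\<^sub>R x"] sublinear_scale[OF sub, of q t x] that
            by (simp add: field_simps)
        qed
        then show ?thesis using that by (simp add: field_simps)
      qed
      ultimately have "sublinear u" by (simp add: sublinear_def)
      moreover have "u \<le> p"
        using False u_le qp by (metis all_not_in_conv le_funI order_trans)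
      ultimately show ?thesis
        using u_le by (auto simp: A_def le_fun_def)
    qed
  qed
  then obtain l where "sublinear l" "l \<le> p" and min: "\<And>q. q \<in> A \<Longrightarrow> q \<le> l \<Longrightarrow> q = l"
    by (auto simp: A_def)
  then have "linear l"
    by (intro linear_if_minimal_sublinear) (auto simp: A_def)
  then show ?thesis using \<open>l \<le> p\<close> that by blast
qed

text \<open>Descent from the norm along \<open>x\<^sub>0\<close> builds the norming condition into
  \<open>q\<close>; every linear functional below \<open>q\<close> inherits it, so no extension from
  a subspace is involved.\<close>

lemma real_norming_functional:
  fixes x\<^sub>0 :: "'a::real_normed_vector"
  obtains l :: "'a \<Rightarrow> real" where "linear l" and "\<And>x. l x \<le> norm x" and "l x\<^sub>0 = norm x\<^sub>0"
proof -
  have "sublinear (norm :: 'a \<Rightarrow> real)"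
    by (simp add: sublinear_def norm_triangle_ineq)
  then obtain q :: "'a \<Rightarrow> real" where q: "sublinear q" "q \<le> norm" "q (- x\<^sub>0) \<le> - norm x\<^sub>0"
    by (rule sublinear_descent)
  obtain l where l: "linear l" "l \<le> q"
    using linear_below_sublinear[OF q(1)] .
  have le: "l x \<le> norm x" for x
    using l(2) q(2) by (auto simp: le_fun_def intro: order_trans)
  have "l (- x\<^sub>0) \<le> - norm x\<^sub>0"
    using l(2) q(3) by (auto simp: le_fun_def intro: order_trans)
  then have "l x\<^sub>0 = norm x\<^sub>0"
    using le[of x\<^sub>0] linear_neg[OF l(1), of x\<^sub>0] by simp
  with l(1) le show ?thesis by (rule that)
qed

lemma scaleC_scaleR:
  fixes x :: "'a::complex_normed_vector"
  shows "c *\<^sub>C (r *\<^sub>R x) = r *\<^sub>R (c *\<^sub>C x)"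
  by (simp add: scaleC_scaleC mult.commute flip: scaleC_of_real)

lemma scaleC_Complex:
  fixes x :: "'a::complex_normed_vector"
  shows "Complex a b *\<^sub>C x = a *\<^sub>R x + b *\<^sub>R (\<i> *\<^sub>C x)"
  by (simp add: Complex_eq scaleC_add_left scaleC_of_real flip: scaleC_scaleC)
     (simp add: scaleC_scaleC mult.commute flip: scaleC_of_real)

text \<open>The standard complexification \<open>l x - i * l (i x)\<close> of a real norming
  functional is complex linear. Rotating \<open>L x\<close> onto the real axis reduces its bound to
  that of \<open>l\<close>.\<close>

lemma complex_norming_functional:
  fixes x\<^sub>0 :: "'a::complex_normed_vector"
  obtains L :: "'a \<Rightarrow> complex" where "bounded_linear L" and "\<And>c x. L (c *\<^sub>C x) = c * L x"
    and "\<And>x. norm (L x) \<le> norm x" and "norm (L x\<^sub>0) = norm x\<^sub>0"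
proof -
  obtain l :: "'a \<Rightarrow> real" where l: "linear l" "\<And>x. l x \<le> norm x" "l x\<^sub>0 = norm x\<^sub>0"
    using real_norming_functional[of x\<^sub>0] by blast
  note lin = linear_add[OF l(1)] linear_diff[OF l(1)] linear_scale[OF l(1)] linear_neg[OF l(1)]
  define L where "L x = Complex (l x) (- l (\<i> *\<^sub>C x))" for x
  have ii: "\<i> *\<^sub>C \<i> *\<^sub>C x = - x" for x :: 'a
    using scaleC_of_real[of "- 1" x] by (simp add: scaleC_scaleC)
  have scale: "L (c *\<^sub>C x) = c * L x" for c x
    using scaleC_Complex[of "Re c" "Im c" x]
    by (simp add: L_def scaleC_add_right scaleC_scaleR ii lin complex_eq_iff)
  have bound: "norm (L x) \<le> norm x" for x
  proof -
    \<comment> \<open>For \<open>L x = 0\<close> this gives \<open>c = 0\<close>; only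
      \<open>norm c \<le> 1\<close> is needed.\<close>
    define c where "c = cnj (sgn (L x))"
    have "complex_of_real (norm (L x)) = c * L x"
      by (simp add: c_def sgn_div_norm scaleR_conv_of_real divide_simps complex_norm_square[symmetric]
            power2_eq_square mult.commute del: of_real_power)
    then have "norm (L x) = Re (L (c *\<^sub>C x))"
      by (metis scale Re_complex_of_real)
    also have "\<dots> \<le> norm (c *\<^sub>C x)"
      by (simp add: L_def l(2))
    also have "\<dots> \<le> norm x"
      by (simp add: norm_scaleC c_def norm_sgn)
    finally show ?thesis .
  qed
  have "L (x + y) = L x + L y" for x y
    by (simp add: L_def lin scaleC_add_right complex_eq_iff)
  moreover have "L (r *\<^sub>R x) = r *\<^sub>R L x" for r x
    using scale[of "of_real r" x] by (simp add: scaleC_of_real scaleR_conv_of_real)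
  ultimately have "bounded_linear L"
    using bound by (intro bounded_linear_intro[where K = 1]) auto
  moreover have "norm (L x\<^sub>0) = norm x\<^sub>0"
    using bound[of x\<^sub>0] complex_Re_le_cmod[of "L x\<^sub>0"] l(3) by (simp add: L_def)
  ultimately show ?thesis
    using scale bound that by blast
qed

subsection \<open>Holomorphic maps\<close>

lemma bounded_linear_scaleC_left: "bounded_linear (\<lambda>c. c *\<^sub>C (v::'a::complex_normed_vector))"
proof (rule bounded_linear_intro[where K = "norm v"])
  show "(r *\<^sub>R c) *\<^sub>C v = r *\<^sub>R (c *\<^sub>C v)" for r c
    by (simp add: scaleR_conv_of_real flip: scaleC_scaleC scaleC_of_real)
qed (simp_all add: scaleC_add_left norm_scaleC)

lemma holomorphic_maps_compose:
  assumes "f \<in> holomorphic_maps A B" and "g \<in> holomorphic_maps B C"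
  shows "g \<circ> f \<in> holomorphic_maps A C"
proof -
  have "\<exists>h'. (g \<circ> f has_derivative h') (at x) \<and> (\<forall>c v. h' (c *\<^sub>C v) = c *\<^sub>C h' v)"
    if x: "x \<in> A" for x
  proof -
    have "f x \<in> B"
      using assms x by (auto simp: holomorphic_maps_def)
    then obtain g' where "(g has_derivative g') (at (f x))" "\<forall>c v. g' (c *\<^sub>C v) = c *\<^sub>C g' v"
      using assms(2) unfolding holomorphic_maps_def by blast
    moreover obtain f' where "(f has_derivative f') (at x)" "\<forall>c v. f' (c *\<^sub>C v) = c *\<^sub>C f' v"
      using assms(1) x unfolding holomorphic_maps_def by blast
    ultimately show ?thesis
      by (intro exI[of _ "g' \<circ> f'"]) (auto intro: diff_chain_at)
  qed
  moreover have "(g \<circ> f) ` A \<subseteq> C"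
    using assms by (force simp: holomorphic_maps_def)
  ultimately show ?thesis
    by (simp add: holomorphic_maps_def)
qed

text \<open>Composition with such maps restricts a problem to affine complex discs, where
  one-variable theory applies.\<close>

lemma holomorphic_maps_line:
  fixes a v :: "'a::complex_normed_vector"
  assumes "(\<lambda>z. a + z *\<^sub>C v) ` S \<subseteq> T"
  shows "(\<lambda>z. a + z *\<^sub>C v) \<in> holomorphic_maps S T"
proof -
  have "((\<lambda>z. a + z *\<^sub>C v) has_derivative (\<lambda>z. z *\<^sub>C v)) (at x)" for x
    by (auto intro!: derivative_eq_intros bounded_linear.has_derivative[OF bounded_linear_scaleC_left])
  moreover have "(c *\<^sub>C z) *\<^sub>C v = c *\<^sub>C z *\<^sub>C v" for c z :: complex
    by (simp add: scaleC_complex_def scaleC_scaleC)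
  ultimately show ?thesis
    using assms unfolding holomorphic_maps_def by blast
qed

subsection \<open>The Schwarz-Pick lemma and boundary distance of geodesics\<close>

lemma has_field_derivative_Moebius_function_center:
  assumes "norm w < 1"
  shows "(Moebius_function 0 w has_field_derivative 1 / complex_of_real (1 - (norm w)\<^sup>2)) (at w)"
proof -
  have "cnj w * w = complex_of_real ((norm w)\<^sup>2)"
    by (subst complex_norm_square) (rule mult.commute)
  moreover have "1 - (norm w)\<^sup>2 \<noteq> 0"
    using assms abs_square_less_1[of "norm w"] by auto
  then have "complex_of_real (1 - (norm w)\<^sup>2) \<noteq> 0"
    by (simp only: of_real_eq_0_iff not_False_eq_True)
  ultimately have "1 - cnj w * w = complex_of_real (1 - (norm w)\<^sup>2)" "1 - cnj w * w \<noteq> 0"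
    by simp_all
  moreover have "((\<lambda>z. (z - w) / (1 - cnj w * z)) has_field_derivative
      (1 * (1 - cnj w * w) - (w - w) * (- cnj w)) / ((1 - cnj w * w) * (1 - cnj w * w))) (at w)"
    using calculation(2) by (intro DERIV_divide) (auto intro!: derivative_eq_intros)
  ultimately show ?thesis
    by (simp add: Moebius_function_simple[abs_def])
qed

text \<open>The Moebius map \<open>M\<close> sends \<open>f 0\<close> to \<open>0\<close>, so the
  Schwarz lemma applies to \<open>M \<circ> f\<close>; the chain rule at \<open>0\<close> turns its
  derivative bound into the second claim.\<close>

lemma
  assumes hol: "f holomorphic_on ball 0 1" and im: "f ` ball 0 1 \<subseteq> ball 0 1"
  shows Schwarz_Pick_0: "norm z < 1 \<Longrightarrow> norm (Moebius_function 0 (f 0) (f z)) \<le> norm z"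
    and Schwarz_Pick_deriv_0: "norm (deriv f 0) \<le> 1 - (norm (f 0))\<^sup>2"
proof -
  define M where "M = Moebius_function 0 (f 0)"
  have f: "norm (f z) < 1" if "norm z < 1" for z
    using im that by (auto simp: image_subset_iff)
  have hol_M: "(M \<circ> f) holomorphic_on ball 0 1"
    unfolding M_def using hol im Moebius_function_holomorphic[of "f 0" 0] f[of 0]
    by (auto intro!: holomorphic_on_compose_gen)
  have M0: "(M \<circ> f) 0 = 0"
    by (simp add: M_def Moebius_function_eq_zero)
  have lt: "norm ((M \<circ> f) z) < 1" if "norm z < 1" for z
    using that f by (simp add: M_def Moebius_function_norm_lt_1)
  show "norm (Moebius_function 0 (f 0) (f z)) \<le> norm z" if "norm z < 1"
    using Schwarz_Lemma(1)[OF hol_M M0 lt that] by (simp add: M_def)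
  have pos: "0 < 1 - (norm (f 0))\<^sup>2"
    using f[of 0] by (simp add: power_less_one_iff abs_square_less_1)
  have "(f has_field_derivative deriv f 0) (at 0)"
    using hol by (auto intro: holomorphic_derivI)
  moreover have "(M has_field_derivative 1 / complex_of_real (1 - (norm (f 0))\<^sup>2)) (at (f 0))"
    unfolding M_def using f[of 0] by (intro has_field_derivative_Moebius_function_center) simp
  ultimately have "(M \<circ> f has_field_derivative
      1 / complex_of_real (1 - (norm (f 0))\<^sup>2) * deriv f 0) (at 0)"
    by (rule DERIV_chain[rotated])
  then have "deriv (M \<circ> f) 0 = 1 / complex_of_real (1 - (norm (f 0))\<^sup>2) * deriv f 0"
    by (rule DERIV_imp_deriv)
  then have "norm (deriv (M \<circ> f) 0) = norm (deriv f 0) / (1 - (norm (f 0))\<^sup>2)"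
    using pos by (simp only: norm_mult norm_divide norm_of_real) simp
  moreover have "norm (deriv (M \<circ> f) 0) \<le> 1"
    using Schwarz_Lemma(2)[OF hol_M M0 lt, of 0] by (simp del: o_apply)
  ultimately show "norm (deriv f 0) \<le> 1 - (norm (f 0))\<^sup>2"
    using pos by (metis divide_le_eq_1_pos)
qed

section \<open>Pseudohyperbolic distance and the Caratheodory distance of the unit ball\<close>

lemma one_minus_cnj_mult_nonzero:
  fixes z w :: complex
  assumes "norm z < 1" "norm w < 1"
  shows "1 - cnj w * z \<noteq> 0"
proof -
  have "norm (cnj w * z) < 1"
    using assms norm_mult_less[of "cnj w" 1 z 1] by simp
  then show ?thesis by auto
qed

text \<open>Moebius invariance of the pseudohyperbolic distance: numerator and denominator acquire
  the factors \<open>d / (p * q)\<close> and \<open>d / (p * cnj q)\<close>, which have equal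
  modulus.\<close>

lemma norm_Moebius_function_invariant:
  assumes "norm w < 1" "norm x < 1" "norm y < 1"
  shows "norm (Moebius_function 0 (Moebius_function 0 w y) (Moebius_function 0 w x))
    = norm (Moebius_function 0 y x)"
proof -
  define d where "d = 1 - cnj w * w"
  define p where "p = 1 - cnj w * x"
  define q where "q = 1 - cnj w * y"
  have nz: "d \<noteq> 0" "p \<noteq> 0" "q \<noteq> 0" "cnj q \<noteq> 0"
    unfolding d_def p_def q_def complex_cnj_zero_iff
    by (simp_all only: one_minus_cnj_mult_nonzero assms not_False_eq_True)
  have "(x - w) / p - (y - w) / q = d * (x - y) / (p * q)"
    using nz(2,3) by (simp add: divide_simps) (simp add: d_def p_def q_def algebra_simps)
  moreover have "1 - cnj ((y - w) / q) * ((x - w) / p) = d * (1 - cnj y * x) / (p * cnj q)"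
    using nz(2,4) by (simp add: divide_simps) (simp add: d_def p_def q_def algebra_simps)
  ultimately show ?thesis
    using nz by (simp add: Moebius_function_simple norm_divide norm_mult flip: p_def q_def)
qed

text \<open>The right-hand side equals \<open>(1 - |P|^2) (1 - |Q|^2) / |1 - cnj Q * P|^2\<close>,
  and this denominator is at most \<open>4\<close>.\<close>

lemma one_minus_norm_Moebius_function_ge:
  assumes P: "norm P \<le> a" "a < 1" and Q: "norm Q \<le> b" "b < 1"
  shows "(1 - a\<^sup>2) * (1 - b\<^sup>2) / 4 \<le> 1 - (norm (Moebius_function 0 Q P))\<^sup>2"
proof -
  let ?d = "1 - cnj Q * P"
  have nz: "?d \<noteq> 0"
    using P Q by (intro one_minus_cnj_mult_nonzero) auto
  have "(norm ?d)\<^sup>2 - (norm (P - Q))\<^sup>2 = (1 - (norm P)\<^sup>2) * (1 - (norm Q)\<^sup>2)"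
    by (simp add: cmod_power2) (simp add: power2_eq_square algebra_simps)
  then have "1 - (norm (Moebius_function 0 Q P))\<^sup>2
      = (1 - (norm P)\<^sup>2) * (1 - (norm Q)\<^sup>2) / (norm ?d)\<^sup>2"
    using nz by (simp add: Moebius_function_simple norm_divide power_divide divide_simps)
  moreover have sq: "(norm P)\<^sup>2 \<le> a\<^sup>2" "(norm Q)\<^sup>2 \<le> b\<^sup>2" "a\<^sup>2 \<le> 1" "b\<^sup>2 \<le> 1"
    using P Q norm_ge_zero[of P] norm_ge_zero[of Q]
    by (auto simp: abs_square_le_1 simp del: norm_ge_zero intro: power_mono)
  moreover have "(norm ?d)\<^sup>2 \<le> 4"
  proof -
    have "norm (cnj Q * P) \<le> 1 * 1"
      using P Q unfolding norm_mult by (intro mult_mono) auto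
    then have "norm ?d \<le> 2"
      using norm_triangle_ineq4[of 1 "cnj Q * P"] by simp
    then show ?thesis
      using power_mono[of "norm ?d" 2 2] by simp
  qed
  moreover have "0 < (norm ?d)\<^sup>2"
    using nz by (simp only: zero_less_power zero_less_norm_iff not_False_eq_True)
  moreover have "(1 - a\<^sup>2) * (1 - b\<^sup>2) \<le> (1 - (norm P)\<^sup>2) * (1 - (norm Q)\<^sup>2)"
    using sq by (intro mult_mono) auto
  moreover have "0 \<le> (1 - a\<^sup>2) * (1 - b\<^sup>2)"
    using sq by simp
  ultimately show ?thesis
    using frac_le[of "(1 - (norm P)\<^sup>2) * (1 - (norm Q)\<^sup>2)" "(1 - a\<^sup>2) * (1 - b\<^sup>2)"
        "(norm ?d)\<^sup>2" 4] by linarith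
qed

lemma artanh_less:
  fixes x y :: real
  assumes "0 \<le> x" "x < y" "y < 1"
  shows "artanh x < artanh y"
  using assms by (auto simp: artanh_def field_simps)

text \<open>After \<open>f 0\<close> is moved to \<open>0\<close>, Schwarz-Pick bounds the images of
  \<open>p\<close> and \<open>q\<close> by \<open>norm p\<close> and \<open>norm q\<close>. Moebius
  invariance then estimates every test map by the same quantity.\<close>

lemma caratheodory_dist_unit_ball_le:
  fixes p q :: "'a::complex_normed_vector"
  assumes p: "norm p < 1" and q: "norm q < 1"
  shows "caratheodory_dist (ball 0 1) p q
    \<le> ennreal (artanh (sqrt (1 - (1 - (norm p)\<^sup>2) * (1 - (norm q)\<^sup>2) / 4)))"
  unfolding caratheodory_dist_def
proof (intro SUP_least ennreal_leI)
  fix f :: "'a \<Rightarrow> complex"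
  assume f: "f \<in> holomorphic_maps (ball 0 1) (ball 0 1)"
  then have f_lt: "norm (f x) < 1" if "norm x < 1" for x
    using that by (auto simp: holomorphic_maps_def image_subset_iff)
  define M where "M = Moebius_function 0 (f 0)"
  have M_le: "norm (M (f x)) \<le> norm x" if x: "norm x < 1" for x
  proof (cases "x = 0")
    case True
    then show ?thesis by (simp add: M_def Moebius_function_eq_zero)
  next
    case False
    \<comment> \<open>The complex line through \<open>0\<close> and \<open>x\<close> meets the ball
      in a disc parametrized by \<open>z *\<^sub>C e\<close>, with \<open>x\<close> at the parameter
      \<open>norm x\<close>.\<close>
    define e where "e = x /\<^sub>R norm x"
    have e: "norm e = 1" "of_real (norm x) *\<^sub>C e = x"
      using False by (simp_all add: e_def scaleC_of_real)
    have "(\<lambda>z. 0 + z *\<^sub>C e) \<in> holomorphic_maps (ball 0 1) (ball 0 1)"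
      by (rule holomorphic_maps_line) (auto simp: norm_scaleC e)
    then have "f \<circ> (\<lambda>z. 0 + z *\<^sub>C e) \<in> holomorphic_maps (ball 0 1) (ball 0 1)"
      using f by (rule holomorphic_maps_compose)
    then have "f \<circ> (\<lambda>z. 0 + z *\<^sub>C e) holomorphic_on ball 0 1"
        "(f \<circ> (\<lambda>z. 0 + z *\<^sub>C e)) ` ball 0 1 \<subseteq> ball 0 1"
      by (simp_all add: holomorphic_maps_complex_iff)
    from Schwarz_Pick_0[OF this, of "of_real (norm x)"] show ?thesis
      using x e scaleC_of_real[of 0 e] by (simp add: M_def)
  qed
  let ?m = "norm (Moebius_function 0 (f q) (f p))"
  let ?T = "1 - (1 - (norm p)\<^sup>2) * (1 - (norm q)\<^sup>2) / 4"
  have "(1 - (norm p)\<^sup>2) * (1 - (norm q)\<^sup>2) / 4 \<le> 1 - ?m\<^sup>2"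
    using one_minus_norm_Moebius_function_ge[OF M_le[OF p] p M_le[OF q] q]
      norm_Moebius_function_invariant[of "f 0" "f p" "f q"] f_lt p q by (simp add: M_def)
  then have le: "?m \<le> sqrt ?T"
    by (intro real_le_rsqrt) simp
  have "(norm p)\<^sup>2 < 1" "(norm q)\<^sup>2 < 1"
    using p q by (simp_all add: power_less_one_iff abs_square_less_1)
  then have "sqrt ?T < 1"
    by simp
  then show "poincare_dist (f p) (f q) \<le> artanh (sqrt ?T)"
    using le artanh_less[of ?m "sqrt ?T"]
    by (cases "?m = sqrt ?T") (auto simp: poincare_dist_def Moebius_function_simple)
qed

text \<open>With \<open>v = 0\<close> the geodesic equation equates \<open>artanh (norm u)\<close>
  with a Caratheodory distance whose upper bound depends only on \<open>norm (\<phi> u)\<close> and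
  \<open>norm (\<phi> 0)\<close>.\<close>

lemma complex_geodesic_boundary_distance:
  fixes \<phi> :: "complex \<Rightarrow> 'a::complex_normed_vector"
  assumes geo: "complex_geodesic (ball 0 1) \<phi>"
  obtains K where "K > 0" and "\<And>u. norm u < 1 \<Longrightarrow> 1 - norm (\<phi> u) \<le> K * (1 - norm u)"
proof -
  have lt: "norm (\<phi> u) < 1" if "norm u < 1" for u
    using geo that by (auto simp: complex_geodesic_def holomorphic_maps_def image_subset_iff)
  define B where "B = 1 - (norm (\<phi> 0))\<^sup>2"
  have B: "B > 0" "B \<le> 1"
    using lt[of 0] by (simp_all add: B_def power_less_one_iff abs_square_less_1)
  \<comment> \<open>In \<open>8 / B\<close> a factor \<open>4\<close> comes from the Moebius
    estimate and a factor \<open>2\<close> from \<open>1 + norm u \<le> 2\<close>.\<close>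
  have "1 - norm (\<phi> u) \<le> 8 / B * (1 - norm u)" if u: "norm u < 1" for u
  proof -
    define a where "a = 1 - (norm (\<phi> u))\<^sup>2"
    have a: "0 < a" "a \<le> 1" "1 - norm (\<phi> u) \<le> a"
      using lt[OF u] by (simp_all add: a_def power_less_one_iff abs_square_less_1)
         (simp add: power2_eq_square mult_left_le)
    have aB: "0 < a * B" "a * B \<le> 1"
      using a B by (simp_all add: mult_le_one)
    have "ennreal (artanh (norm u)) = caratheodory_dist (ball 0 1) (\<phi> u) (\<phi> 0)"
      using geo u unfolding complex_geodesic_def
      by (metis (no_types, lifting) centre_in_ball zero_less_one mem_ball_0 poincare_dist_def
          complex_cnj_zero diff_zero mult_zero_left div_by_1)
    also have "\<dots> \<le> ennreal (artanh (sqrt (1 - a * B / 4)))"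
      unfolding a_def B_def using u lt by (intro caratheodory_dist_unit_ball_le) auto
    finally have le: "ennreal (artanh (norm u)) \<le> ennreal (artanh (sqrt (1 - a * B / 4)))" .
    have "norm u \<le> sqrt (1 - a * B / 4)"
    proof (rule ccontr)
      assume "\<not> ?thesis"
      then have less: "sqrt (1 - a * B / 4) < norm u" by simp
      have "0 \<le> sqrt (1 - a * B / 4)"
        using aB by simp
      moreover from this less have "0 < norm u"
        by linarith
      \<comment> \<open>Positivity of the larger value matters because \<open>ennreal\<close> sends
        all negative reals to \<open>0\<close>.\<close>
      ultimately have "artanh (sqrt (1 - a * B / 4)) < artanh (norm u)" "0 < artanh (norm u)"
        using artanh_less[OF _ less u] artanh_less[of 0 "norm u"] u by simp_all
      then show False
        using le by (simp add: ennreal_le_iff2)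
    qed
    then have "(norm u)\<^sup>2 \<le> 1 - a * B / 4"
      using aB power_mono[of "norm u" "sqrt (1 - a * B / 4)" 2] by simp
    then have "a * B / 4 \<le> (1 - norm u) * (1 + norm u)"
      by (simp add: power2_eq_square algebra_simps)
    also have "\<dots> \<le> (1 - norm u) * 2"
      using u by (intro mult_left_mono) auto
    finally have "a \<le> 8 / B * (1 - norm u)"
      using B by (simp add: field_simps)
    with a show ?thesis by simp
  qed
  with B show ?thesis
    by (intro that[of "8 / B"]) auto
qed

subsection \<open>Derivative bound and boundary extension\<close>

text \<open>A functional norming the very point \<open>x\<close> to be estimated reduces the claim
  to the disc self-map \<open>h\<close>, the composition of \<open>L\<close> with
  \<open>\<phi>\<close> on the disc about \<open>u\<close> of radius \<open>1 - norm u\<close>; then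
  \<open>L x = h 0 + \<zeta> / 2 * deriv h 0\<close>.\<close>

lemma disc_along_derivative_in_unit_ball:
  fixes \<phi> :: "complex \<Rightarrow> 'a::complex_normed_vector"
  assumes \<phi>: "\<phi> \<in> holomorphic_maps (ball 0 1) (ball 0 1)"
    and d: "(\<phi> has_derivative (\<lambda>z. z *\<^sub>C d)) (at u)"
    and u: "norm u < 1" and \<zeta>: "norm \<zeta> < 1"
  shows "norm (\<phi> u + \<zeta> *\<^sub>C (((1 - norm u) / 2) *\<^sub>R d)) < 1"
proof -
  define x where "x = \<phi> u + \<zeta> *\<^sub>C (((1 - norm u) / 2) *\<^sub>R d)"
  define r where "r = complex_of_real (1 - norm u)"
  obtain L :: "'a \<Rightarrow> complex" where lin: "bounded_linear L" and scale: "\<And>c x. L (c *\<^sub>C x) = c * L x"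
    and bound: "\<And>x. norm (L x) \<le> norm x" and norming: "norm (L x) = norm x"
    using complex_norming_functional[of x] by blast
  define h where "h = L \<circ> (\<phi> \<circ> (\<lambda>z. u + z *\<^sub>C r))"
  have "u + z * r \<in> ball 0 1" if "norm z < 1" for z
  proof -
    have "norm (z * r) < 1 - norm u"
      using that u mult_strict_right_mono[of "norm z" 1 "1 - norm u"]
      by (simp add: r_def norm_mult del: of_real_diff)
    then show ?thesis
      using norm_triangle_ineq[of u "z * r"] by simp
  qed
  then have "(\<lambda>z. u + z *\<^sub>C r) \<in> holomorphic_maps (ball 0 1) (ball 0 1)"
    by (intro holomorphic_maps_line) (auto simp: scaleC_complex_def)
  moreover have "L ` ball 0 1 \<subseteq> ball 0 1"
    using bound by (auto intro: le_less_trans[OF bound])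
  then have "L \<in> holomorphic_maps (ball 0 1) (ball 0 1)"
    using bounded_linear_imp_has_derivative[OF lin] scale
    unfolding holomorphic_maps_def scaleC_complex_def by blast
  ultimately have "h \<in> holomorphic_maps (ball 0 1) (ball 0 1)"
    using \<phi> unfolding h_def by (blast intro: holomorphic_maps_compose)
  then have h: "h holomorphic_on ball 0 1" "h ` ball 0 1 \<subseteq> ball 0 1"
    by (simp_all add: holomorphic_maps_complex_iff)
  have "((\<lambda>z. u + z * r) has_derivative (\<lambda>z. z * r)) (at 0)"
    by (auto intro!: derivative_eq_intros)
  moreover have "(\<phi> has_derivative (\<lambda>z. z *\<^sub>C d)) (at (u + 0 * r))"
    using d by simp
  ultimately have "(\<phi> \<circ> (\<lambda>z. u + z * r) has_derivative (\<lambda>z. z *\<^sub>C d) \<circ> (\<lambda>z. z * r)) (at 0)"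
    by (rule diff_chain_at)
  from bounded_linear.has_derivative[OF lin this]
  have "(h has_derivative (\<lambda>z. L ((z * r) *\<^sub>C d))) (at 0)"
    by (simp add: h_def o_def scaleC_complex_def)
  then have "(h has_field_derivative r * L d) (at 0)"
    by (rule has_derivative_imp_has_field_derivative) (simp add: scale)
  then have deriv: "deriv h 0 = r * L d"
    by (rule DERIV_imp_deriv)
  have h0: "norm (h 0) < 1"
    using h(2) by (simp add: image_subset_iff)
  have r: "norm r = 1 - norm u" "((1 - norm u) / 2) *\<^sub>R d = (r / 2) *\<^sub>C d"
    using u scaleC_of_real[of "(1 - norm u) / 2" d] by (simp_all add: r_def norm_of_real del: of_real_diff)
  have "x = \<phi> u + (\<zeta> / 2 * r) *\<^sub>C d"
    by (simp add: x_def r(2) scaleC_scaleC)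
  then have "L x = h 0 + \<zeta> / 2 * deriv h 0"
    using linear_add[OF bounded_linear.linear[OF lin]] deriv
    by (simp add: h_def scale scaleC_complex_def)
  then have "norm x \<le> norm (h 0) + norm (\<zeta> / 2 * deriv h 0)"
    using norming norm_triangle_ineq by metis
  also have "norm (\<zeta> / 2 * deriv h 0) \<le> 1 / 2 * (1 - (norm (h 0))\<^sup>2)"
    unfolding norm_mult using \<zeta> Schwarz_Pick_deriv_0[OF h] by (intro mult_mono) auto
  \<comment> \<open>Halving the radius is essential: \<open>a + (1 - a^2)\<close> exceeds
    \<open>1\<close> for \<open>0 < a < 1\<close>.\<close>
  also have "norm (h 0) + 1 / 2 * (1 - (norm (h 0))\<^sup>2) = 1 - (1 - norm (h 0))\<^sup>2 / 2"
    by (simp add: power2_eq_square field_simps)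
  also have "\<dots> < 1"
    using h0 by simp
  finally show ?thesis by (simp add: x_def)
qed

text \<open>Radial projection gives a boundary point at this distance; at the centre, where it is
  undefined, \<open>v\<close> serves instead.\<close>

lemma infdist_frontier_unit_ball_le:
  fixes z v :: "'a::real_normed_vector"
  assumes "norm z < 1" and "norm v = 1"
  shows "infdist z (frontier (ball 0 1)) \<le> 1 - norm z"
proof (cases "z = 0")
  case True
  then show ?thesis
    using assms infdist_le[of v "sphere 0 1" z] by simp
next
  case False
  have "z - z /\<^sub>R norm z = (1 - 1 / norm z) *\<^sub>R z"
    by (simp add: algebra_simps divide_inverse)
  then have "dist z (z /\<^sub>R norm z) = \<bar>1 - 1 / norm z\<bar> * norm z"
    by (simp add: dist_norm)
  also have "\<dots> = 1 - norm z"
    using False assms by (simp add: field_simps abs_if)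
  finally show ?thesis
    using False infdist_le[of "z /\<^sub>R norm z" "sphere 0 1" z] by simp
qed

text \<open>The affine disc in direction \<open>d\<close> has radius
  \<open>(1 - norm u) / 2 * norm d\<close>, so this number competes in the suprema defining the
  modulus at \<open>1 - norm (\<phi> u)\<close>.\<close>

lemma derivative_bound_of_convexity_modulus:
  fixes \<phi> :: "complex \<Rightarrow> 'a::complex_normed_vector"
  assumes \<phi>: "\<phi> \<in> holomorphic_maps (ball 0 1) (ball 0 1)"
    and d: "(\<phi> has_derivative (\<lambda>z. z *\<^sub>C d)) (at u)" and u: "norm u < 1"
    and modulus: "complex_convexity_modulus (ball (0::'a) 1) (1 - norm (\<phi> u)) \<le> ennreal b"
    and "b \<ge> 0"
  shows "norm d * (1 - norm u) \<le> 2 * b"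
proof (cases "d = 0")
  case True
  with \<open>b \<ge> 0\<close> show ?thesis by simp
next
  case False
  define v where "v = d /\<^sub>R norm d"
  define r where "r = (1 - norm u) / 2 * norm d"
  have v: "norm v = 1" and r: "r > 0"
    using False u by (simp_all add: v_def r_def)
  have \<phi>u: "norm (\<phi> u) < 1"
    using \<phi> u by (auto simp: holomorphic_maps_def image_subset_iff)
  have "\<phi> u + r *\<^sub>R \<zeta> *\<^sub>C v \<in> ball 0 1" if "norm \<zeta> < 1" for \<zeta>
  proof -
    have "r *\<^sub>R \<zeta> *\<^sub>C v = \<zeta> *\<^sub>C (((1 - norm u) / 2) *\<^sub>R d)"
      using False by (simp add: r_def v_def scaleC_scaleR)
    then show ?thesis
      using disc_along_derivative_in_unit_ball[OF \<phi> d u that] by simp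
  qed
  then have "ennreal r \<le> disc_radius (ball 0 1) (\<phi> u) v"
    unfolding disc_radius_def using r by (intro SUP_upper) auto
  also have "\<dots> \<le> complex_convexity_modulus (ball (0::'a) 1) (1 - norm (\<phi> u))"
    unfolding complex_convexity_modulus_def
    by (rule SUP_upper2[where i = "(\<phi> u, v)"])
       (use v \<phi>u infdist_frontier_unit_ball_le[OF \<phi>u v] in auto)
  also note modulus
  finally show ?thesis
    using \<open>b \<ge> 0\<close> by (simp add: r_def mult.commute)
qed

text \<open>The derivative bound is integrable along radii because \<open>s > 0\<close>, with tails
  independent of the direction. Hence the dilations of \<open>\<phi>\<close> are uniformly Cauchy on
  the closed disc.\<close>

lemma Hardy_Littlewood_extension:
  fixes \<phi> :: "complex \<Rightarrow> 'a::banach"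
  assumes s: "0 < s" "s \<le> 1" and "C \<ge> 0"
    and deriv: "\<And>z. norm z < 1 \<Longrightarrow> (\<phi> has_derivative \<phi>' z) (at z)"
    and bound: "\<And>z v. norm z < 1 \<Longrightarrow> norm (\<phi>' z v) \<le> C * (1 - norm z) powr (s - 1) * norm v"
  obtains \<psi> where "continuous_on (cball 0 1) \<psi>" and "\<And>z. norm z < 1 \<Longrightarrow> \<psi> z = \<phi> z"
proof -
  have cont: "isCont \<phi> z" if "norm z < 1" for z
    using deriv[OF that] by (rule has_derivative_continuous)
  have lt: "norm (of_real r * z) < 1" if "0 \<le> r" "r < 1" "norm z \<le> 1" for r and z :: complex
    using that mult_mono[of "norm z" 1 r r] by (simp add: norm_mult mult.commute)
  have radial: "norm (\<phi> (of_real r' * z) - \<phi> (of_real r * z)) \<le> C / s * (1 - r) powr s"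
    if r: "0 \<le> r" "r < r'" "r' < 1" and z: "norm z \<le> 1" for r r' z
  proof -
    define f where "f = (\<lambda>t. \<phi> (of_real t * z))"
    \<comment> \<open>An antiderivative of the bound
      \<open>C * (1 - t) powr (s - 1)\<close>.\<close>
    define g where "g = (\<lambda>t. - C / s * (1 - t) powr s)"
    have f_deriv: "(f has_vector_derivative \<phi>' (of_real t * z) z) (at t)" if "0 \<le> t" "t < 1" for t
    proof -
      have "((\<lambda>t. of_real t * z) has_vector_derivative z) (at t)"
        by (auto intro!: derivative_eq_intros)
      from vector_derivative_diff_chain_within[OF this, of \<phi> "\<phi>' (of_real t * z)"]
      show ?thesis
        using deriv[OF lt[OF that z]] by (simp add: f_def o_def has_derivative_at_withinI)
    qed
    have g_deriv: "(g has_real_derivative C * (1 - t) powr (s - 1)) (at t)" if "t < 1" for t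
      unfolding g_def using that s by (auto intro!: derivative_eq_intros simp: divide_simps)
    have "norm (f r' - f r) \<le> g r' - g r"
    proof (rule differentiable_bound_general[OF r(2)])
      show "continuous_on {r..r'} f"
        using r by (intro continuous_at_imp_continuous_on ballI
            has_vector_derivative_continuous[OF f_deriv]) auto
      show "continuous_on {r..r'} g"
        using r by (intro continuous_at_imp_continuous_on ballI DERIV_isCont[OF g_deriv]) auto
      fix t assume t: "r < t" "t < r'"
      show "(f has_vector_derivative \<phi>' (of_real t * z) z) (at t)"
        using f_deriv r t by simp
      show "(g has_vector_derivative C * (1 - t) powr (s - 1)) (at t)"
        using g_deriv r t by (simp add: has_real_derivative_iff_has_vector_derivative)
      have "norm (of_real t * z) \<le> t"
        using z r t by (simp add: norm_mult mult_left_le)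
      \<comment> \<open>Here \<open>s \<le> 1\<close> enters: a nonpositive exponent makes the power
        decreasing.\<close>
      then have "(1 - norm (of_real t * z)) powr (s - 1) \<le> (1 - t) powr (s - 1)"
        using s r t by (intro powr_mono2') auto
      then have "C * (1 - norm (of_real t * z)) powr (s - 1) * norm z \<le> C * (1 - t) powr (s - 1) * 1"
        using z \<open>C \<ge> 0\<close> by (intro mult_mono) auto
      moreover have "norm (of_real t * z) < 1"
        using lt z r t by simp
      ultimately show "norm (\<phi>' (of_real t * z) z) \<le> C * (1 - t) powr (s - 1)"
        using bound[of "of_real t * z" z] by simp
    qed
    also have "\<dots> \<le> C / s * (1 - r) powr s"
      using s \<open>C \<ge> 0\<close> by (simp add: g_def)
    finally show ?thesis by (simp add: f_def)
  qed
  \<comment> \<open>Any sequence in \<open>[0, 1)\<close> increasing strictly to \<open>1\<close>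
    would do; strictness matches \<open>r < r'\<close> in \<open>radial\<close>.\<close>
  define \<rho> where "\<rho> = (\<lambda>n. 1 - 1 / real (Suc (Suc n)))"
  have \<rho>: "0 \<le> \<rho> n" "\<rho> n < 1" for n
    by (simp_all add: \<rho>_def)
  have \<rho>_lim: "\<rho> \<longlonglongrightarrow> 1"
    unfolding \<rho>_def by real_asymp
  define F where "F = (\<lambda>n z. \<phi> (of_real (\<rho> n) * z))"
  have "uniformly_Cauchy_on (cball 0 1) F"
  proof (rule uniformly_Cauchy_onI')
    fix e :: real assume "e > 0"
    have "(\<lambda>n. C / s * (1 - \<rho> n) powr s) \<longlonglongrightarrow> C / s * 0"
      using s unfolding \<rho>_def by (intro tendsto_mult_left) (simp, real_asymp)
    with \<open>e > 0\<close> have "\<forall>\<^sub>F n in sequentially. C / s * (1 - \<rho> n) powr s < e"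
      by (intro order_tendstoD) simp_all
    then obtain N where N: "\<And>n. n \<ge> N \<Longrightarrow> C / s * (1 - \<rho> n) powr s < e"
      by (auto simp: eventually_sequentially)
    have "dist (F m z) (F n z) < e" if "z \<in> cball 0 1" "m \<ge> N" "m < n" for z m n
    proof -
      have "\<rho> m < \<rho> n"
        using that by (simp add: \<rho>_def field_simps)
      then have "norm (F n z - F m z) \<le> C / s * (1 - \<rho> m) powr s"
        unfolding F_def using that \<rho> by (intro radial) auto
      then show ?thesis
        using N[OF that(2)] by (simp add: dist_norm norm_minus_commute)
    qed
    then show "\<exists>M. \<forall>z\<in>cball 0 1. \<forall>m\<ge>M. \<forall>n>m. dist (F m z) (F n z) < e"
      by blast
  qed
  then obtain \<psi> where \<psi>: "uniform_limit (cball 0 1) F \<psi> sequentially"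
    using Cauchy_uniformly_convergent by (auto simp: uniformly_convergent_on_def)
  have "continuous_on (cball 0 1) (F n)" for n
  proof (rule continuous_at_imp_continuous_on, rule ballI)
    fix z :: complex assume "z \<in> cball 0 1"
    then have "isCont \<phi> (of_real (\<rho> n) * z)"
      using cont lt \<rho> by simp
    then show "isCont (F n) z"
      unfolding F_def by (intro isCont_o2[of z "\<lambda>z. of_real (\<rho> n) * z" \<phi>]) auto
  qed
  then have "continuous_on (cball 0 1) \<psi>"
    using uniform_limit_theorem[OF _ \<psi>] by simp
  moreover have "\<psi> z = \<phi> z" if "norm z < 1" for z
  proof (rule LIMSEQ_unique)
    show "(\<lambda>n. F n z) \<longlonglongrightarrow> \<psi> z"
      using tendsto_uniform_limitI[OF \<psi>] that by simp
    have "(\<lambda>n. of_real (\<rho> n) * z) \<longlonglongrightarrow> of_real 1 * z"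
      by (intro tendsto_intros \<rho>_lim)
    then show "(\<lambda>n. F n z) \<longlonglongrightarrow> \<phi> z"
      unfolding F_def using cont[OF that] by (intro isCont_tendsto_compose[of z \<phi>]) auto
  qed
  ultimately show ?thesis by (rule that)
qed

theorem theorem4p4:
  fixes A s :: real and \<phi> :: "complex \<Rightarrow> 'a::complex_banach"
  assumes "complex_uniformly_convex (ball (0::'a) 1)"
    and "A > 0" and "s > 0"
    and "\<And>\<epsilon>. \<epsilon> > 0 \<Longrightarrow>
      complex_convexity_modulus (ball (0::'a) 1) \<epsilon> \<le> ennreal (A * \<epsilon> powr s)"
    and "complex_geodesic (ball 0 1) \<phi>"
  shows "\<exists>\<psi>. continuous_on (closure (ball 0 1)) \<psi> \<and>
    \<psi> ` closure (ball 0 1) \<subseteq> closure (ball 0 1) \<and>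
    (\<forall>z\<in>ball 0 1. \<psi> z = \<phi> z)"
proof -
  \<comment> \<open>The extension lemma needs an exponent at most \<open>1\<close>. Lowering
    \<open>s\<close> is harmless because the modulus is used only at some
    \<open>\<epsilon> \<le> 1\<close>.\<close>
  define \<sigma> where "\<sigma> = min s 1"
  have \<sigma>: "0 < \<sigma>" "\<sigma> \<le> 1" "\<sigma> \<le> s"
    using assms(3) by (auto simp: \<sigma>_def)
  have \<phi>: "\<phi> \<in> holomorphic_maps (ball 0 1) (ball 0 1)"
    using assms(5) by (simp add: complex_geodesic_def)
  then have \<phi>_lt: "norm (\<phi> u) < 1" if "norm u < 1" for u
    using that by (auto simp: holomorphic_maps_def image_subset_iff)
  obtain K where K: "K > 0" "\<And>u. norm u < 1 \<Longrightarrow> 1 - norm (\<phi> u) \<le> K * (1 - norm u)"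
    using complex_geodesic_boundary_distance[OF assms(5)] by blast
  \<comment> \<open>The factor \<open>2\<close> undoes the halved disc radius;
    \<open>K powr \<sigma>\<close> comes from the boundary distance estimate.\<close>
  define C where "C = 2 * (A * K powr \<sigma>)"
  have "\<exists>d. (\<phi> has_derivative (\<lambda>z. z *\<^sub>C d)) (at u)" if u: "norm u < 1" for u
  proof -
    have "u \<in> ball 0 1"
      using u by simp
    then obtain F where F: "(\<phi> has_derivative F) (at u)" "\<forall>c v. F (c *\<^sub>C v) = c *\<^sub>C F v"
      using \<phi> unfolding holomorphic_maps_def by blast
    have "F = (\<lambda>z. z *\<^sub>C F 1)"
    proof
      \<comment> \<open>Complex linearity on the one-dimensional space of scalars, with
        \<open>z\<close> taken as the scalar.\<close>
      show "F z = z *\<^sub>C F 1" for z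
        using F(2)[rule_format, of z 1] by (simp only: scaleC_complex_def mult_1_right)
    qed
    with F(1) have "(\<phi> has_derivative (\<lambda>z. z *\<^sub>C F 1)) (at u)"
      by simp
    then show ?thesis ..
  qed
  then obtain d where d: "\<And>u. norm u < 1 \<Longrightarrow> (\<phi> has_derivative (\<lambda>z. z *\<^sub>C d u)) (at u)"
    by metis
  have d_le: "norm (d u) \<le> C * (1 - norm u) powr (\<sigma> - 1)" if u: "norm u < 1" for u
  proof -
    define \<epsilon> where "\<epsilon> = 1 - norm (\<phi> u)"
    have \<epsilon>: "0 < \<epsilon>" "\<epsilon> \<le> 1" "\<epsilon> \<le> K * (1 - norm u)"
      using \<phi>_lt[OF u] K(2)[OF u] by (simp_all add: \<epsilon>_def)
    have "norm (d u) * (1 - norm u) \<le> 2 * (A * \<epsilon> powr s)"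
      using assms(2) assms(4)[OF \<epsilon>(1)]
      by (intro derivative_bound_of_convexity_modulus[OF \<phi> d[OF u] u]) (auto simp: \<epsilon>_def)
    also have "\<epsilon> powr s \<le> \<epsilon> powr \<sigma>"
      using \<epsilon> \<sigma> by (intro powr_mono') auto
    also have "\<epsilon> powr \<sigma> \<le> (K * (1 - norm u)) powr \<sigma>"
      using \<epsilon> \<sigma> by (intro powr_mono2) auto
    also have "2 * (A * (K * (1 - norm u)) powr \<sigma>) = C * (1 - norm u) powr (\<sigma> - 1) * (1 - norm u)"
      using u K(1) by (simp add: C_def powr_mult powr_diff)
    finally show ?thesis
      using u assms(2) by simp
  qed
  obtain \<psi> where \<psi>: "continuous_on (cball 0 1) \<psi>" "\<And>z. norm z < 1 \<Longrightarrow> \<psi> z = \<phi> z"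
  proof (rule Hardy_Littlewood_extension[of \<sigma> C \<phi> "\<lambda>u z. z *\<^sub>C d u"])
    show "norm (v *\<^sub>C d z) \<le> C * (1 - norm z) powr (\<sigma> - 1) * norm v" if "norm z < 1" for z v
      using mult_left_mono[OF d_le[OF that], of "norm v"] by (simp add: norm_scaleC mult.commute)
  qed (use \<sigma> d assms(2) in \<open>auto simp: C_def\<close>)
  \<comment> \<open>Values on the unit circle are limits of values of \<open>\<phi>\<close>, so
    continuity keeps them in the closed ball.\<close>
  have "\<psi> ` closure (ball 0 1) \<subseteq> closure (ball 0 1)"
  proof (rule image_closure_subset)
    show "\<psi> ` ball 0 1 \<subseteq> closure (ball 0 1)"
      using \<psi>(2) \<phi>_lt by (auto simp: less_imp_le)
  qed (use \<psi>(1) in auto)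
  then show ?thesis
    using \<psi> by (intro exI[of _ \<psi>]) auto
qed

end
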